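(* Let $Q=[-1,1]^n$ be the unit $\infty$-norm ball, $p\in\mathbb{R}^n$, $\psi(x)=p\cdot x$, and $\varepsilon\ge0$. Then $$\mathbb{P}(\mathrm{ER}^c(\varepsilon))\ \le\ \frac{1}{\sqrt{2\pi}}\,\varepsilon\,\|p\|_1\exp\big(\varepsilon\sqrt{n-1}\,\|p\|\big).$$
   Context: $\|\cdot\|$ is the Euclidean norm and $\|\cdot\|_1$ the $1$-norm. Let $g\sim\mathcal N(0,I_n)$. (LP): minimize $-g\cdot x$ over $x\in Q$. $(P_\varepsilon)$: minimize $-g\cdot x+\varepsilon\psi(x)$ over $x\in Q$. With probability 1, (LP) has a unique solution $z^\star$, a vertex of $Q$. $\mathrm{ER}(\varepsilon)$ is the event that $z^\star$ is also a solution of $(P_\varepsilon)$, and $\mathrm{ER}^c(\varepsilon)$ is its complement. *)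

theory Defs
  imports "HOL-Probability.Probability"
begin

definition std_gaussian_density :: "real ^ 'n \<Rightarrow> real" where
  "std_gaussian_density x = (2 * pi) powr (- (real CARD('n) / 2)) * exp (- (norm x)\<^sup>2 / 2)"

definition std_gaussian_vector :: "'w measure \<Rightarrow> ('w \<Rightarrow> real ^ 'n) \<Rightarrow> bool" where
  "std_gaussian_vector M g \<longleftrightarrow> distributed M lborel g (\<lambda>x. ennreal (std_gaussian_density x))"

definition one_norm :: "real ^ 'n \<Rightarrow> real" where
  "one_norm p = (\<Sum>i\<in>UNIV. \<bar>p $ i\<bar>)"

definition LP_solution :: "(real ^ 'n) set \<Rightarrow> real ^ 'n \<Rightarrow> real ^ 'n \<Rightarrow> bool" where
  "LP_solution Q c z \<longleftrightarrow> is_arg_min (\<lambda>x. - (c \<bullet> x)) (\<lambda>x. x \<in> Q) z"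

definition P_solution ::
  "(real ^ 'n) set \<Rightarrow> (real ^ 'n \<Rightarrow> real) \<Rightarrow> real \<Rightarrow> real ^ 'n \<Rightarrow> real ^ 'n \<Rightarrow> bool" where
  "P_solution Q \<psi> \<epsilon> c z \<longleftrightarrow> is_arg_min (\<lambda>x. - (c \<bullet> x) + \<epsilon> * \<psi> x) (\<lambda>x. x \<in> Q) z"

(* Outcomes for which (LP) does not have a unique solution are not in ER, so they are counted
   in the complement. *)
definition ER ::
  "'w measure \<Rightarrow> ('w \<Rightarrow> real ^ 'n) \<Rightarrow> (real ^ 'n) set \<Rightarrow> (real ^ 'n \<Rightarrow> real) \<Rightarrow> real \<Rightarrow> 'w set"
  where
  "ER M g Q \<psi> \<epsilon> = {\<omega> \<in> space M. \<exists>z. LP_solution Q (g \<omega>) z \<and>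
      (\<forall>y. LP_solution Q (g \<omega>) y \<longrightarrow> y = z) \<and> P_solution Q \<psi> \<epsilon> (g \<omega>) z}"

end

theory Submission
  imports Defs
begin

text \<open>
  On the cube both linear programs separate over the coordinates: the solution of (LP) is unique iff
  all entries of the cost vector \<open>g\<close> are nonzero, it is then the vector of signs of \<open>g\<close>, and it also
  solves the perturbed problem iff \<open>g $ i\<close> and \<open>g $ i - \<epsilon> * p $ i\<close> never have opposite signs.
  Hence recovery can only fail if some \<open>g $ i\<close> lies between \<open>0\<close> and \<open>\<epsilon> * p $ i\<close>. Since the standard
  normal density is at most \<open>1 / sqrt (2 * pi)\<close>, a union bound gives the estimate even without the
  exponential factor.
\<close>

lemma sqrt_two_pi_eq_exp: "sqrt (2 * pi) = exp (ln (2 * pi) / 2)"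
  using powr_half_sqrt[of "2 * pi"] by (simp only: powr_def) simp

text \<open>With the normalising constant moved into the exponent, a product of such densities is
  the exponential of a sum, so \<open>exp_sum\<close> factorises the Gaussian density over the
  coordinates.\<close>

lemma std_normal_density_eq_exp:
  "std_normal_density t = exp (- ln (2 * pi) / 2 - t\<^sup>2 / 2)"
  by (simp only: sqrt_two_pi_eq_exp std_normal_density_def exp_diff exp_minus
      minus_divide_left[symmetric] divide_inverse mult_1_left mult_minus_left)

lemma power2_norm_eq_sum_Basis: "(norm x)\<^sup>2 = (\<Sum>b\<in>Basis. (x \<bullet> b)\<^sup>2)"
  for x :: "'a::euclidean_space"
  unfolding power2_norm_eq_inner by (subst euclidean_inner) (simp add: power2_eq_square)

lemma std_gaussian_density_eq_exp:
  "std_gaussian_density x = exp (\<Sum>b\<in>Basis. - ln (2 * pi) / 2 - (x \<bullet> b)\<^sup>2 / 2)"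
  for x :: "real ^ 'n"
  unfolding std_gaussian_density_def powr_def
  by (simp add: power2_norm_eq_sum_Basis sum_subtractf sum_divide_distrib exp_add[symmetric])

lemma std_gaussian_density_eq_prod:
  "std_gaussian_density x = (\<Prod>b\<in>Basis. std_normal_density (x \<bullet> b))"
  for x :: "real ^ 'n"
  by (simp only: std_gaussian_density_eq_exp std_normal_density_eq_exp exp_sum finite_Basis)

lemma nn_integral_std_normal_density: "(\<integral>\<^sup>+ t. ennreal (std_normal_density t) \<partial>lborel) = 1"
  using prob_space.emeasure_space_1[OF prob_space_normal_density[of 1 0]]
  by (simp add: emeasure_density)

text \<open>The condition on coordinate \<open>i\<close> is absorbed into the factor of
  \<open>axis i 1\<close>, and every other factor is multiplied by 1. Each factor then depends on
  one coordinate only, as Tonelli requires.\<close>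

lemma std_gaussian_density_indicator_eq_prod:
  fixes x :: "real ^ 'n"
  shows "ennreal (std_gaussian_density x) * indicator A (x $ i) =
    (\<Prod>b\<in>Basis. ennreal (std_normal_density (x \<bullet> b)) *
      (if b = axis i 1 then indicator A (x \<bullet> b) else 1))"
  by (simp add: std_gaussian_density_eq_prod prod.distrib prod_ennreal inner_axis axis_in_Basis_iff)

text \<open>By Tonelli the integral is a product of one-dimensional integrals. All of them except
  the one for \<open>axis i 1\<close> are total masses of the standard normal law, hence 1.\<close>

lemma nn_integral_std_gaussian_density_coord:
  fixes i :: "'n::finite"
  assumes [measurable]: "A \<in> sets borel"
  shows "(\<integral>\<^sup>+ x. ennreal (std_gaussian_density (x :: real ^ 'n)) * indicator A (x $ i) \<partial>lborel) =
    (\<integral>\<^sup>+ t. ennreal (std_normal_density t) * indicator A t \<partial>lborel)"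
proof -
  have "(\<integral>\<^sup>+ t. ennreal (std_normal_density t) *
        (if b = axis i 1 then indicator A t else 1) \<partial>lborel) =
      (if b = axis i 1 then \<integral>\<^sup>+ t. ennreal (std_normal_density t) * indicator A t \<partial>lborel else 1)"
    for b :: "real ^ 'n"
    by (simp add: nn_integral_std_normal_density)
  then show ?thesis
    unfolding std_gaussian_density_indicator_eq_prod
    by (subst nn_integral_lborel_prod) (simp_all add: axis_in_Basis_iff)
qed

lemma emeasure_std_gaussian_vector_coord:
  fixes g :: "'w \<Rightarrow> real ^ 'n"
  assumes g: "std_gaussian_vector M g" and A: "A \<in> sets borel"
  shows "emeasure M {\<omega> \<in> space M. g \<omega> $ i \<in> A} =
    (\<integral>\<^sup>+ t. ennreal (std_normal_density t) * indicator A t \<partial>lborel)"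
proof -
  have S: "{x :: real ^ 'n. x $ i \<in> A} \<in> sets borel"
    using A by measurable
  have "emeasure M {\<omega> \<in> space M. g \<omega> $ i \<in> A} = emeasure M (g -` {x. x $ i \<in> A} \<inter> space M)"
    by (rule arg_cong[where f = "emeasure M"]) auto
  also have "\<dots> = (\<integral>\<^sup>+ x. ennreal (std_gaussian_density x) * indicator {x. x $ i \<in> A} x \<partial>lborel)"
    using g S by (intro distributed_emeasure) (simp_all add: std_gaussian_vector_def)
  also have "\<dots> = (\<integral>\<^sup>+ x. ennreal (std_gaussian_density x) * indicator A (x $ i) \<partial>lborel)"
    by (simp add: indicator_def)
  finally show ?thesis
    by (simp only: nn_integral_std_gaussian_density_coord[OF A])
qed

lemma measure_std_gaussian_vector_coord_le:
  fixes g :: "'w \<Rightarrow> real ^ 'n"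
  assumes g: "std_gaussian_vector M g" and "a \<le> b"
  shows "measure M {\<omega> \<in> space M. g \<omega> $ i \<in> {a..b}} \<le> (b - a) / sqrt (2 * pi)"
proof -
  have "emeasure M {\<omega> \<in> space M. g \<omega> $ i \<in> {a..b}} =
      (\<integral>\<^sup>+ t. ennreal (std_normal_density t) * indicator {a..b} t \<partial>lborel)"
    by (rule emeasure_std_gaussian_vector_coord[OF g]) simp
  also have "\<dots> \<le> (\<integral>\<^sup>+ t. ennreal (1 / sqrt (2 * pi)) * indicator {a..b} t \<partial>lborel)"
    by (intro nn_integral_mono mult_right_mono ennreal_leI)
      (auto simp: std_normal_density_def divide_simps)
  also have "\<dots> = ennreal ((b - a) / sqrt (2 * pi))"
    using \<open>a \<le> b\<close> by (simp add: nn_integral_cmult_indicator ennreal_mult[symmetric])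
  finally show ?thesis
    using \<open>a \<le> b\<close> by (simp add: measure_def enn2real_leI)
qed

text \<open>The objective is a sum of terms \<open>c $ i * x $ i\<close>, each at most
  \<open>\<bar>c $ i\<bar>\<close> on the cube. One point attains all these bounds at once, so the
  optimal points are those that attain every one of them. A coordinate with \<open>c $ i = 0\<close>
  remains free.\<close>

lemma LP_solution_box_iff:
  fixes c z :: "real ^ 'n"
  shows "LP_solution (cbox (\<chi> i. - 1) (\<chi> i. 1)) c z \<longleftrightarrow>
    (\<forall>i. \<bar>z $ i\<bar> \<le> 1 \<and> c $ i * z $ i = \<bar>c $ i\<bar>)"
    (is "LP_solution ?Q c z \<longleftrightarrow> ?R")
proof -
  have box: "x \<in> ?Q \<longleftrightarrow> (\<forall>i. \<bar>x $ i\<bar> \<le> 1)" for x :: "real ^ 'n"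
    by (auto simp: mem_box_cart abs_le_iff minus_le_iff)
  have le: "c $ i * x $ i \<le> \<bar>c $ i\<bar>" if "\<bar>x $ i\<bar> \<le> 1" for x :: "real ^ 'n" and i
  proof -
    have "c $ i * x $ i \<le> \<bar>c $ i\<bar> * \<bar>x $ i\<bar>"
      by (metis abs_ge_self abs_mult)
    also have "\<dots> \<le> \<bar>c $ i\<bar>"
      using that by (simp add: mult_left_le)
    finally show ?thesis .
  qed
  have inner: "c \<bullet> x = (\<Sum>i\<in>UNIV. c $ i * x $ i)" for x
    by (simp add: inner_vec_def)
  show ?thesis
  proof
    assume L: "LP_solution ?Q c z"
    then have z: "\<bar>z $ i\<bar> \<le> 1" for i
      by (auto simp: LP_solution_def is_arg_min_def box)
    \<comment> \<open>The sign vector attains every coordinate bound, so the optimal value is the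
      sum of the \<open>\<bar>c $ i\<bar>\<close>.\<close>
    define s where "s = (\<chi> i. sgn (c $ i))"
    have "s \<in> ?Q"
      by (simp add: box s_def abs_sgn_eq)
    then have "c \<bullet> s \<le> c \<bullet> z"
      using L by (auto simp: LP_solution_def is_arg_min_def not_less)
    moreover have "c \<bullet> s = (\<Sum>i\<in>UNIV. \<bar>c $ i\<bar>)"
      by (simp add: inner s_def abs_sgn)
    ultimately have "(\<Sum>i\<in>UNIV. c $ i * z $ i) = (\<Sum>i\<in>UNIV. \<bar>c $ i\<bar>)"
      using le z inner[of z] by (intro antisym[OF sum_mono]) simp_all
    \<comment> \<open>Termwise inequality together with equality of the sums forces equality in each
      term.\<close>
    then have "c $ i * z $ i = \<bar>c $ i\<bar>" for i
      using sum_mono_inv[of "\<lambda>i. c $ i * z $ i" UNIV "\<lambda>i. \<bar>c $ i\<bar>" i] le z by auto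
    with z show ?R by blast
  next
    assume R: ?R
    then have "c \<bullet> x \<le> c \<bullet> z" if "x \<in> ?Q" for x
      using that le by (auto simp: inner box intro!: sum_mono)
    moreover have "z \<in> ?Q" using R by (simp add: box)
    ultimately show "LP_solution ?Q c z"
      by (fastforce simp: LP_solution_def is_arg_min_def)
  qed
qed

text \<open>A linear penalty only shifts the cost vector, so the description of the optimal points
  of (LP) also covers the perturbed problem.\<close>

lemma P_solution_linear:
  "P_solution Q (\<lambda>x. p \<bullet> x) \<epsilon> c z \<longleftrightarrow> LP_solution Q (c - \<epsilon> *\<^sub>R p) z"
  by (simp add: P_solution_def LP_solution_def inner_diff_left algebra_simps)

lemma LP_solution_box_unique_iff:
  fixes c z :: "real ^ 'n"
  defines "Q \<equiv> cbox (\<chi> i. - 1) (\<chi> i. 1)"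
  shows "LP_solution Q c z \<and> (\<forall>y. LP_solution Q c y \<longrightarrow> y = z) \<longleftrightarrow>
    (\<forall>i. c $ i \<noteq> 0) \<and> z = (\<chi> i. sgn (c $ i))"
proof
  assume L: "LP_solution Q c z \<and> (\<forall>y. LP_solution Q c y \<longrightarrow> y = z)"
  have nz: "c $ j \<noteq> 0" for j
  proof
    assume j: "c $ j = 0"
    \<comment> \<open>Coordinate \<open>j\<close> does not affect the objective. Its new value, 0 or
      1, is chosen to differ from \<open>z $ j\<close> without leaving the cube, which gives a
      second solution.\<close>
    define y where "y = (\<chi> i. if i = j then (if z $ j = 0 then 1 else 0) else z $ i)"
    have z: "\<bar>z $ i\<bar> \<le> 1 \<and> c $ i * z $ i = \<bar>c $ i\<bar>" for i
      using L[THEN conjunct1] by (simp add: Q_def LP_solution_box_iff)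
    have "\<bar>y $ i\<bar> \<le> 1 \<and> c $ i * y $ i = \<bar>c $ i\<bar>" for i
      using z[of i] j by (cases "i = j") (simp_all add: y_def)
    then have "LP_solution Q c y"
      by (simp add: Q_def LP_solution_box_iff)
    with L have "y = z" by blast
    then have "y $ j = z $ j" by simp
    then show False by (simp add: y_def split: if_splits)
  qed
  have "LP_solution Q c (\<chi> i. sgn (c $ i))"
    by (simp add: Q_def LP_solution_box_iff abs_sgn_eq abs_sgn)
  with L nz show "(\<forall>i. c $ i \<noteq> 0) \<and> z = (\<chi> i. sgn (c $ i))" by auto
next
  assume R: "(\<forall>i. c $ i \<noteq> 0) \<and> z = (\<chi> i. sgn (c $ i))"
  have "LP_solution Q c z"
    using R by (simp add: Q_def LP_solution_box_iff abs_sgn_eq abs_sgn)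
  moreover have "y = z" if "LP_solution Q c y" for y
  proof -
    \<comment> \<open>Both sides equal \<open>\<bar>c $ i\<bar>\<close>; the nonzero factor
      \<open>c $ i\<close> can then be cancelled.\<close>
    have "c $ i * y $ i = c $ i * sgn (c $ i)" for i
      using that by (simp add: Q_def LP_solution_box_iff abs_sgn)
    then show ?thesis using R by (simp add: vec_eq_iff)
  qed
  ultimately show "LP_solution Q c z \<and> (\<forall>y. LP_solution Q c y \<longrightarrow> y = z)" by blast
qed

text \<open>The inequality is weak because the sign vector need not be the only solution of the
  perturbed problem: an entry of the shifted cost may vanish.\<close>

lemma ER_box_linear:
  "ER M g (cbox (\<chi> i. - 1) (\<chi> i. 1)) (\<lambda>x. p \<bullet> x) \<epsilon> =
    {\<omega> \<in> space M. \<forall>i. g \<omega> $ i \<noteq> 0 \<and> sgn (g \<omega> $ i) * (g \<omega> $ i - \<epsilon> * p $ i) \<ge> 0}"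
proof -
  have sol: "LP_solution (cbox (\<chi> i. - 1) (\<chi> i. 1)) d (\<chi> i. sgn (c $ i)) \<longleftrightarrow>
      (\<forall>i. sgn (c $ i) * d $ i \<ge> 0)" if "\<forall>i. c $ i \<noteq> 0" for c d :: "real ^ 'n"
  proof -
    \<comment> \<open>Since \<open>c $ i\<close> is nonzero, its sign is 1 or -1. The product
      therefore has absolute value \<open>\<bar>d $ i\<bar>\<close> and equals it exactly when it is
      nonnegative.\<close>
    have "d $ i * sgn (c $ i) = \<bar>d $ i\<bar> \<longleftrightarrow> sgn (c $ i) * d $ i \<ge> 0" for i
      using that[rule_format, of i] by (auto simp: sgn_if)
    then show ?thesis by (simp add: LP_solution_box_iff abs_sgn_eq)
  qed
  have "ER M g (cbox (\<chi> i. - 1) (\<chi> i. 1)) (\<lambda>x. p \<bullet> x) \<epsilon> =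
      {\<omega> \<in> space M. (\<forall>i. g \<omega> $ i \<noteq> 0) \<and>
        LP_solution (cbox (\<chi> i. - 1) (\<chi> i. 1)) (g \<omega> - \<epsilon> *\<^sub>R p) (\<chi> i. sgn (g \<omega> $ i))}"
    unfolding ER_def P_solution_linear conj_assoc[symmetric] LP_solution_box_unique_iff by auto
  also have "\<dots> = {\<omega> \<in> space M. \<forall>i. g \<omega> $ i \<noteq> 0 \<and>
      sgn (g \<omega> $ i) * (g \<omega> $ i - \<epsilon> * p $ i) \<ge> 0}"
    by (rule Collect_cong) (use sol in \<open>force simp del: zero_le_mult_iff\<close>)
  finally show ?thesis .
qed

theorem corollary4p5:
  fixes M :: "'w measure" and g :: "'w \<Rightarrow> real ^ 'n" and Q :: "(real ^ 'n) set"
    and p :: "real ^ 'n" and \<psi> :: "real ^ 'n \<Rightarrow> real" and \<epsilon> :: real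
  assumes "prob_space M"
    and "std_gaussian_vector M g"
    and "Q = cbox (\<chi> i. - 1) (\<chi> i. 1)"
    and "\<psi> = (\<lambda>x. p \<bullet> x)"
    and "\<epsilon> \<ge> 0"
  shows "space M - ER M g Q \<psi> \<epsilon> \<in> sets M \<and>
    measure M (space M - ER M g Q \<psi> \<epsilon>)
      \<le> 1 / sqrt (2 * pi) * \<epsilon> * one_norm p * exp (\<epsilon> * sqrt (real CARD('n) - 1) * norm p)"
proof
  have fin: "finite_measure M"
    using \<open>prob_space M\<close> by (rule prob_space.finite_measure)
  have [measurable]: "g \<in> borel_measurable M"
    using assms(2) distributed_measurable[of M lborel g] by (simp add: std_gaussian_vector_def)
  have [measurable]: "(\<lambda>\<omega>. g \<omega> $ i) \<in> borel_measurable M" for i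
    using borel_measurable_inner[of g M "\<lambda>_. axis i 1"] by (simp add: inner_axis)
  \<comment> \<open>Finitely many conditions on single coordinates describe the event; both its
    measurability and the union bound are read off from them.\<close>
  have ER: "ER M g Q \<psi> \<epsilon> =
      {\<omega> \<in> space M. \<forall>i. g \<omega> $ i \<noteq> 0 \<and> sgn (g \<omega> $ i) * (g \<omega> $ i - \<epsilon> * p $ i) \<ge> 0}"
    unfolding assms(3,4) by (rule ER_box_linear)
  show "space M - ER M g Q \<psi> \<epsilon> \<in> sets M"
    unfolding ER by measurable
  \<comment> \<open>\<open>min\<close> and \<open>max\<close> treat both signs of
    \<open>p $ i\<close> together. The interval is closed, so it contains 0 and also covers the
    outcomes where (LP) has several solutions.\<close>
  define B where
    "B i = {\<omega> \<in> space M. g \<omega> $ i \<in> {min 0 (\<epsilon> * p $ i)..max 0 (\<epsilon> * p $ i)}}" for i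
  have B [measurable]: "B i \<in> sets M" for i
    unfolding B_def by measurable
  have "space M - ER M g Q \<psi> \<epsilon> \<subseteq> (\<Union>i. B i)"
  proof
    fix \<omega> assume "\<omega> \<in> space M - ER M g Q \<psi> \<epsilon>"
    then obtain i where "\<omega> \<in> space M"
      and "\<not> (g \<omega> $ i \<noteq> 0 \<and> sgn (g \<omega> $ i) * (g \<omega> $ i - \<epsilon> * p $ i) \<ge> 0)"
      unfolding ER by blast
    then have "\<omega> \<in> B i"
      by (auto simp: B_def sgn_if split: if_splits)
    then show "\<omega> \<in> (\<Union>i. B i)" by blast
  qed
  then have "measure M (space M - ER M g Q \<psi> \<epsilon>) \<le> measure M (\<Union>i. B i)"
    by (intro finite_measure.finite_measure_mono[OF fin]) auto
  also have "\<dots> \<le> (\<Sum>i\<in>UNIV. measure M (B i))"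
    by (rule finite_measure.finite_measure_subadditive_finite[OF fin]) auto
  also have "\<dots> \<le> (\<Sum>i\<in>UNIV. \<epsilon> * \<bar>p $ i\<bar> / sqrt (2 * pi))"
  proof (rule sum_mono)
    fix i
    have "measure M (B i) \<le> (max 0 (\<epsilon> * p $ i) - min 0 (\<epsilon> * p $ i)) / sqrt (2 * pi)"
      unfolding B_def by (rule measure_std_gaussian_vector_coord_le[OF assms(2)]) simp
    also have "max 0 (\<epsilon> * p $ i) - min 0 (\<epsilon> * p $ i) = \<bar>\<epsilon> * p $ i\<bar>"
      by (simp add: max_def min_def)
    finally show "measure M (B i) \<le> \<epsilon> * \<bar>p $ i\<bar> / sqrt (2 * pi)"
      using \<open>\<epsilon> \<ge> 0\<close> by (simp add: abs_mult)
  qed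
  also have "\<dots> = 1 / sqrt (2 * pi) * \<epsilon> * one_norm p"
    by (simp add: one_norm_def sum_distrib_left sum_divide_distrib)
  also have "\<dots> \<le> 1 / sqrt (2 * pi) * \<epsilon> * one_norm p *
      exp (\<epsilon> * sqrt (real CARD('n) - 1) * norm p)"
  proof -
    \<comment> \<open>\<open>CARD('n)\<close> is at least 1, so the root and hence the whole
      exponent are nonnegative.\<close>
    have "(1 :: real) \<le> exp (\<epsilon> * sqrt (real CARD('n) - 1) * norm p)"
      using \<open>\<epsilon> \<ge> 0\<close> by simp
    moreover have "0 \<le> 1 / sqrt (2 * pi) * \<epsilon> * one_norm p"
      using \<open>\<epsilon> \<ge> 0\<close> by (simp add: one_norm_def sum_nonneg)
    ultimately show ?thesis
      by (metis mult_left_mono mult.right_neutral)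
  qed
  finally show "measure M (space M - ER M g Q \<psi> \<epsilon>)
      \<le> 1 / sqrt (2 * pi) * \<epsilon> * one_norm p * exp (\<epsilon> * sqrt (real CARD('n) - 1) * norm p)" .
qed

end
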